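(* Let $X$ be a path connected paracompact Hausdorff space whose cardinality is non-measurable. Then $X$, regarded as a subspace of its Stone–Čech compactification $\beta X$, is a path component of $\beta X$.
   Context: All spaces are assumed to be Hausdorff; in particular paracompact spaces are Hausdorff. As usual, path connected spaces are nonempty. For a completely regular Hausdorff space $X$, the Stone–Čech compactification $\beta X$ is the compact Hausdorff space containing $X$ as a dense (topologically embedded) subspace such that every continuous function $f: X \to [0,1]$ extends to a continuous function $\widehat f: \beta X \to [0,1]$. Measurability of cardinals is in the sense of Gillman and Jerison (Rings of Continuous Functions, Chapter 12): a cardinal $\kappa$ is called measurable if, for a set $S$ of cardinality $\kappa$, there is a countably additive function $\mu$ defined on all subsets of $S$, with values in $\{0,1\}$, such that $\mu(S)=1$ and $\mu(\{s\})=0$ for every $s\in S$ (equivalently, $S$ carries a nonprincipal countably complete ultrafilter). A cardinal is non-measurable if it is not measurable in this sense. *)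

theory Defs
  imports "HOL-Analysis.Analysis"
begin

definition paracompact_space :: "'a topology \<Rightarrow> bool" where
  "paracompact_space X \<longleftrightarrow>
     (\<forall>\<U>. (\<forall>U\<in>\<U>. openin X U) \<and> \<Union>\<U> = topspace X \<longrightarrow>
        (\<exists>\<V>. (\<forall>V\<in>\<V>. openin X V) \<and> \<Union>\<V> = topspace X \<and>
             (\<forall>V\<in>\<V>. \<exists>U\<in>\<U>. V \<subseteq> U) \<and> locally_finite_in X \<V>))"

text \<open>
  The Stone-Cech compactification is given by its defining property rather than by one particular
  construction: \<open>B\<close> is a Stone-Cech compactification of \<open>X\<close>, into which \<open>X\<close> is embedded by \<open>e\<close>.
  Complete regularity and the Hausdorff property of \<open>X\<close> follow from the first three conditions.
\<close>

definition stone_cech_compactification ::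
    "'a topology \<Rightarrow> 'b topology \<Rightarrow> ('a \<Rightarrow> 'b) \<Rightarrow> bool" where
  "stone_cech_compactification X B e \<longleftrightarrow>
     compact_space B \<and> Hausdorff_space B \<and>
     embedding_map X B e \<and> B closure_of (e ` topspace X) = topspace B \<and>
     (\<forall>f. continuous_map X (top_of_set {0..1::real}) f \<longrightarrow>
        (\<exists>g. continuous_map B (top_of_set {0..1::real}) g \<and> (\<forall>x\<in>topspace X. g (e x) = f x)))"

text \<open>
  Measurability in the sense of Gillman and Jerison: only countable (not \<open>\<kappa>\<close>-) additivity is
  required. Since the values are \<open>0\<close> and \<open>1\<close>, countable additivity forces \<open>\<mu> {} = 0\<close>.
\<close>

definition nontrivial_two_valued_measure :: "'a set \<Rightarrow> ('a set \<Rightarrow> ennreal) \<Rightarrow> bool" where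
  "nontrivial_two_valued_measure S \<mu> \<longleftrightarrow>
     countably_additive (Pow S) \<mu> \<and> \<mu> \<in> Pow S \<rightarrow> {0, 1} \<and> \<mu> S = 1 \<and> (\<forall>s\<in>S. \<mu> {s} = 0)"

definition measurable_cardinal :: "'a rel \<Rightarrow> bool" where
  "measurable_cardinal \<kappa> \<longleftrightarrow>
     Card_order \<kappa> \<and>
     (\<exists>S :: 'a set. (card_of S, \<kappa>) \<in> ordIso \<and> (\<exists>\<mu>. nontrivial_two_valued_measure S \<mu>))"

text \<open>The choice of the set \<open>S\<close> of cardinality \<open>\<kappa>\<close> is immaterial.\<close>

lemma nontrivial_two_valued_measure_transfer:
  assumes f: "bij_betw f S T" and \<mu>: "nontrivial_two_valued_measure S \<mu>"
  shows "nontrivial_two_valued_measure T (\<lambda>A. \<mu> (f -` A \<inter> S))"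
proof -
  have ca: "countably_additive (Pow S) \<mu>" and v: "\<mu> \<in> Pow S \<rightarrow> {0, 1}" and 1: "\<mu> S = 1"
    and 0: "\<And>s. s \<in> S \<Longrightarrow> \<mu> {s} = 0"
    using \<mu> by (auto simp: nontrivial_two_valued_measure_def)
  have "(\<Sum>i. \<mu> (f -` A i \<inter> S)) = \<mu> (f -` (\<Union>i. A i) \<inter> S)"
    if "disjoint_family A" for A :: "nat \<Rightarrow> 'b set"
  proof -
    have "disjoint_family (\<lambda>i. f -` A i \<inter> S)"
      using that by (fastforce simp: disjoint_family_on_def)
    moreover have "range (\<lambda>i. f -` A i \<inter> S) \<subseteq> Pow S" "(\<Union>i. f -` A i \<inter> S) \<in> Pow S" by auto
    ultimately have "(\<Sum>i. \<mu> (f -` A i \<inter> S)) = \<mu> (\<Union>i. f -` A i \<inter> S)"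
      using ca unfolding countably_additive_def by blast
    also have "(\<Union>i. f -` A i \<inter> S) = f -` (\<Union>i. A i) \<inter> S" by auto
    finally show ?thesis .
  qed
  moreover have "f -` T \<inter> S = S"
    using f by (auto simp: bij_betw_def)
  moreover have "\<mu> (f -` {t} \<inter> S) = 0" if "t \<in> T" for t
  proof -
    obtain s where "s \<in> S" "f s = t" using f \<open>t \<in> T\<close> by (auto simp: bij_betw_def)
    then have "f -` {t} \<inter> S = {s}" using f by (auto simp: bij_betw_def inj_on_def)
    then show ?thesis using 0 \<open>s \<in> S\<close> by simp
  qed
  ultimately show ?thesis
    using v 1 by (auto simp: nontrivial_two_valued_measure_def countably_additive_def Pi_iff)
qed

lemma measurable_cardinal_card_of_iff:
  "measurable_cardinal (card_of T) \<longleftrightarrow> (\<exists>\<mu>. nontrivial_two_valued_measure T \<mu>)"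
proof
  assume "measurable_cardinal (card_of T)"
  then obtain S :: "'a set" and \<mu> f where "bij_betw f S T" "nontrivial_two_valued_measure S \<mu>"
    unfolding measurable_cardinal_def card_of_ordIso[symmetric] by blast
  then show "\<exists>\<mu>. nontrivial_two_valued_measure T \<mu>"
    using nontrivial_two_valued_measure_transfer by blast
next
  assume "\<exists>\<mu>. nontrivial_two_valued_measure T \<mu>"
  then show "measurable_cardinal (card_of T)"
    unfolding measurable_cardinal_def using card_of_Card_order card_of_refl by blast
qed

text \<open>Every completely regular Hausdorff space has a Stone-Cech compactification.\<close>

lemma stone_cech_compactification_exists:
  fixes X :: "'a topology"
  assumes "completely_regular_space X" "Hausdorff_space X"
  shows "\<exists>(B :: (('a \<Rightarrow> real) \<Rightarrow> real) topology) e. stone_cech_compactification X B e"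
proof -
  define K where "K = mspace (submetric (cfunspace X euclidean_metric)
                        {f. f \<in> topspace X \<rightarrow> {0..1::real}})"
  define P where "P = product_topology (\<lambda>f. top_of_set {0..1::real}) K"
  define e where "e = (\<lambda>x. \<lambda>f\<in>K. f x)"
  define B where "B = subtopology P (P closure_of (e ` topspace X))"
  have emb: "embedding_map X P e"
    using completely_regular_space_cube_embedding_explicit[OF assms]
    unfolding K_def P_def e_def .
  then have sub: "e ` topspace X \<subseteq> topspace P"
    unfolding embedding_map_def by (force dest: homeomorphic_imp_surjective_map)
  have cl: "e ` topspace X \<subseteq> P closure_of (e ` topspace X)"
    using closure_of_subset[OF sub] .
  have "compact_space P"
    unfolding P_def compact_space_product_topology by (simp add: compact_space_subtopology)
  then have "compact_space B"
    unfolding B_def by (simp add: closedin_compact_space compact_space_subtopology)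
  moreover have "Hausdorff_space B"
    unfolding B_def P_def
    by (intro Hausdorff_space_subtopology)
       (simp add: Hausdorff_space_product_topology Hausdorff_space_subtopology)
  moreover have "embedding_map X B e"
    using emb cl unfolding B_def by (simp add: embedding_map_in_subtopology)
  moreover have "B closure_of (e ` topspace X) = topspace B"
    using cl unfolding B_def
    by (simp add: closure_of_subtopology closure_of_subset_topspace Int_absorb1 Int_absorb2)
  moreover have "\<exists>g. continuous_map B (top_of_set {0..1::real}) g \<and> (\<forall>x\<in>topspace X. g (e x) = f x)"
    if f: "continuous_map X (top_of_set {0..1::real}) f" for f
  proof -
    define h where "h = restrict f (topspace X)"
    have "continuous_map X euclideanreal h" "h \<in> topspace X \<rightarrow> {0..1}"
      using f unfolding h_def by (auto simp: continuous_map_in_subtopology)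
    moreover from this(2) have "bounded (h ` topspace X)"
      by (intro bounded_subset[OF bounded_closed_interval[of 0 1]]) auto
    ultimately have h: "h \<in> K"
      by (simp add: K_def) (auto simp: h_def)
    then have "continuous_map B (top_of_set {0..1}) (\<lambda>y. y h)"
      unfolding B_def P_def
      by (intro continuous_map_from_subtopology continuous_map_product_projection)
    then show ?thesis
      using h by (intro exI[of _ "\<lambda>y. y h"]) (auto simp: e_def h_def)
  qed
  ultimately show ?thesis
    unfolding stone_cech_compactification_def by blast
qed

end

theory Submission
  imports Defs
begin

text \<open>
  A paracompact Hausdorff space \<open>X\<close> of non-measurable cardinality is realcompact: for every point
  \<open>q\<close> of \<open>\<beta>X\<close> outside \<open>X\<close> some continuous \<open>f : \<beta>X \<rightarrow> [0,1]\<close> vanishes at \<open>q\<close> but nowhere on \<open>X\<close>.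
  A path \<open>p\<close> from \<open>X\<close> to \<open>q\<close> would have a first time \<open>T\<close> with \<open>f (p T) = 0\<close>. But the bounded function
  \<open>sin (1 / f)\<close> on \<open>X\<close> extends continuously to \<open>\<beta>X\<close>, and by density the extension is still
  \<open>sin (1 / f)\<close> wherever \<open>f \<noteq> 0\<close>, so along \<open>p\<close> it oscillates without limit as \<open>t\<close> tends to \<open>T\<close>.
\<close>

section \<open>Two-valued measures from finite traces\<close>

text \<open>On any countable family of sets, \<open>P\<close> coincides with meeting a single finite
  set \<open>F x\<close>. So \<open>P\<close> cannot hold for infinitely many pairwise disjoint
  sets, hence some \<open>A\<close> with \<open>P A\<close> admits no splitting into two pieces that
  both satisfy \<open>P\<close>. The measure of \<open>K\<close> is the truth value of
  \<open>P (K \<inter> A)\<close>.\<close>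

lemma two_valued_measure_of_finite_traces:
  fixes I :: "'i set" and F :: "'x \<Rightarrow> 'i set" and P :: "'i set \<Rightarrow> bool"
  assumes fin: "\<And>x. x \<in> X \<Longrightarrow> finite (F x)"
    and nonempty: "\<And>x. x \<in> X \<Longrightarrow> F x \<noteq> {}"
    and sub: "\<And>x. x \<in> X \<Longrightarrow> F x \<subseteq> I"
    and trace: "\<And>J :: nat \<Rightarrow> 'i set. \<exists>x\<in>X. \<forall>n. P (J n) \<longleftrightarrow> J n \<inter> F x \<noteq> {}"
    and singleton: "\<And>i. i \<in> I \<Longrightarrow> \<not> P {i}"
  shows "\<exists>\<mu>. nontrivial_two_valued_measure I \<mu>"
proof -
  have mono: "P D" if "P C" "C \<subseteq> D" for C D
  proof -
    obtain x where "\<forall>n. P (if n = 0 then C else D) \<longleftrightarrow> (if n = (0::nat) then C else D) \<inter> F x \<noteq> {}"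
      using trace[of "\<lambda>n. if n = 0 then C else D"] by auto
    from this[rule_format, of 0] this[rule_format, of 1] that show ?thesis by auto
  qed
  have I: "P I"
    using trace[of "\<lambda>_. I"] nonempty sub by (metis inf.absorb_iff2)
  \<comment> \<open>If every set satisfying \<open>P\<close> split, then iterating a splitting
    choice \<open>c\<close> from \<open>I\<close> would give a decreasing sequence \<open>S\<close>
    whose differences \<open>D n\<close> are disjoint and satisfy \<open>P\<close>. One finite
    \<open>F x\<close> would have to meet them all.\<close>
  obtain A where A: "P A" and atom: "\<And>C. C \<subseteq> A \<Longrightarrow> \<not> (P C \<and> P (A - C))"
  proof (rule ccontr)
    assume "\<not> thesis"
    then have "\<forall>A. \<exists>C. P A \<longrightarrow> C \<subseteq> A \<and> P C \<and> P (A - C)"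
      using that by metis
    then obtain c where c: "\<And>A. P A \<Longrightarrow> c A \<subseteq> A \<and> P (c A) \<and> P (A - c A)"
      by metis
    define S where "S n = (c ^^ n) I" for n
    have PS: "P (S n)" for n
      by (induction n) (auto simp: S_def I c)
    have dec: "S n \<subseteq> S m" if "m \<le> n" for m n
      using that by (induction rule: dec_induct) (use c PS in \<open>auto simp: S_def\<close>)
    define D where "D n = S n - S (Suc n)" for n
    have PD: "P (D n)" for n
      using c[OF PS[of n]] by (simp add: D_def S_def)
    obtain x where x: "x \<in> X" "\<forall>n. P (D n) \<longleftrightarrow> D n \<inter> F x \<noteq> {}"
      using trace[of D] by blast
    with PD have "\<forall>n. \<exists>i. i \<in> D n \<inter> F x"
      by blast
    then obtain d where d: "\<And>n. d n \<in> D n" "\<And>n. d n \<in> F x"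
      by (metis IntE)
    have "d m \<noteq> d n" if "m < n" for m n
      using d(1)[of m] d(1)[of n] dec[of "Suc m" n] that by (auto simp: D_def)
    then have "inj d"
      by (metis injI linorder_neqE_nat)
    then have "infinite (range d)"
      using finite_imageD by blast
    moreover have "range d \<subseteq> F x"
      using d(2) by blast
    ultimately show False
      using fin[OF x(1)] finite_subset by blast
  qed
  define \<mu> :: "'i set \<Rightarrow> ennreal" where "\<mu> K = (if P (K \<inter> A) then 1 else 0)" for K
  have "(\<Sum>n. \<mu> (K n)) = \<mu> (\<Union>n. K n)" if disj: "disjoint_family K" for K :: "nat \<Rightarrow> 'i set"
  proof (cases "P ((\<Union>n. K n) \<inter> A)")
    case False
    then have "\<mu> (K n) = 0" for n
      using mono[of "K n \<inter> A" "(\<Union>n. K n) \<inter> A"] by (auto simp: \<mu>_def)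
    then show ?thesis
      using False by (simp add: \<mu>_def)
  next
    case True
    \<comment> \<open>The union goes at index 0 and the pieces at the successors, so that one
      \<open>x\<close> serves for all of them: a point of \<open>F x\<close> in the union singles
      out a piece satisfying \<open>P\<close>.\<close>
    obtain x where x: "\<forall>n. P (case n of 0 \<Rightarrow> (\<Union>n. K n) \<inter> A | Suc n \<Rightarrow> K n \<inter> A) \<longleftrightarrow>
        (case n of 0 \<Rightarrow> (\<Union>n. K n) \<inter> A | Suc n \<Rightarrow> K n \<inter> A) \<inter> F x \<noteq> {}"
      using trace[of "\<lambda>n. case n of 0 \<Rightarrow> (\<Union>n. K n) \<inter> A | Suc n \<Rightarrow> K n \<inter> A"] by blast
    from x[rule_format, of 0] True obtain i n where "i \<in> F x" "i \<in> K n" "i \<in> A"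
      by auto
    with x[rule_format, of "Suc n"] have n: "P (K n \<inter> A)"
      by auto
    \<comment> \<open>Two disjoint pieces satisfying \<open>P\<close> would split \<open>A\<close>,
      by monotonicity.\<close>
    have "\<not> P (K m \<inter> A)" if "m \<noteq> n" for m
    proof
      assume "P (K m \<inter> A)"
      moreover have "K m \<inter> A \<subseteq> A - K n \<inter> A"
        using disj that by (auto simp: disjoint_family_on_def)
      ultimately show False
        using atom[of "K n \<inter> A"] n mono by blast
    qed
    then have "\<mu> (K m) = (if m = n then 1 else 0)" for m
      using n by (simp add: \<mu>_def)
    then have "(\<lambda>m. \<mu> (K m)) sums 1"
      using sums_single[of n "\<lambda>_. 1::ennreal"] by simp
    then show ?thesis
      using True by (simp add: \<mu>_def sums_iff)
  qed
  \<comment> \<open>\<open>A\<close> is not known to lie in \<open>I\<close>, so \<open>P\<close> is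
    carried from \<open>A\<close> to \<open>I \<inter> A\<close> by a common \<open>x\<close>, using
    \<open>F x \<subseteq> I\<close>.\<close>
  moreover have "\<mu> I = 1"
  proof -
    obtain x where "x \<in> X" "P A \<longleftrightarrow> A \<inter> F x \<noteq> {}" "P (I \<inter> A) \<longleftrightarrow> I \<inter> A \<inter> F x \<noteq> {}"
      using trace[of "\<lambda>n. if n = 0 then A else I \<inter> A"] by (metis one_neq_zero)
    then show ?thesis
      using A sub[of x] by (auto simp: \<mu>_def)
  qed
  moreover have "\<mu> {i} = 0" if "i \<in> I" for i
    using mono[of "{i} \<inter> A" "{i}"] singleton[OF that] by (auto simp: \<mu>_def)
  moreover have "\<mu> \<in> Pow I \<rightarrow> {0, 1}"
    by (auto simp: \<mu>_def)
  ultimately show ?thesis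
    unfolding nontrivial_two_valued_measure_def countably_additive_def by blast
qed

section \<open>Paracompact spaces: normality, refinements, bump functions\<close>

lemma paracompact_space_refinement:
  assumes "paracompact_space X" "\<forall>U\<in>\<U>. openin X U" "\<Union>\<U> = topspace X"
  obtains \<V> where "\<forall>V\<in>\<V>. openin X V" "\<Union>\<V> = topspace X" "\<forall>V\<in>\<V>. \<exists>U\<in>\<U>. V \<subseteq> U"
    "locally_finite_in X \<V>"
  using assms(1)[unfolded paracompact_space_def, rule_format, of \<U>] assms(2,3) by blast

text \<open>Refine the cover by the \<open>U s\<close> and the complement of \<open>S\<close>, and
  keep the members that meet \<open>S\<close>. By local finiteness the closure of their union is the
  union of their closures, and each of these misses \<open>T\<close>. The form with an arbitrary
  \<open>T\<close> allows it to be applied first to a point and then to a closed set.\<close>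

lemma paracompact_space_separation:
  assumes X: "paracompact_space X" and S: "closedin X S" and "T \<subseteq> topspace X"
    and sep: "\<And>s. s \<in> S \<Longrightarrow> \<exists>U V. openin X U \<and> openin X V \<and> s \<in> U \<and> T \<subseteq> V \<and> disjnt U V"
  shows "\<exists>U V. openin X U \<and> openin X V \<and> S \<subseteq> U \<and> T \<subseteq> V \<and> disjnt U V"
proof -
  obtain U V where UV: "\<And>s. s \<in> S \<Longrightarrow> openin X (U s) \<and> openin X (V s) \<and> s \<in> U s \<and> T \<subseteq> V s \<and> disjnt (U s) (V s)"
    using sep by metis
  let ?\<U> = "insert (topspace X - S) (U ` S)"
  have "\<forall>W\<in>?\<U>. openin X W"
    using UV S by auto
  moreover have "\<Union>?\<U> = topspace X"
    using UV openin_subset by fastforce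
  ultimately obtain \<V> where \<V>: "\<forall>W\<in>\<V>. openin X W" "\<Union>\<V> = topspace X" "\<forall>W\<in>\<V>. \<exists>U\<in>?\<U>. W \<subseteq> U"
      and lf: "locally_finite_in X \<V>"
    by (rule paracompact_space_refinement[OF X])
  define \<W> where "\<W> = {W\<in>\<V>. W \<inter> S \<noteq> {}}"
  have cl: "X closure_of \<Union>\<W> = (\<Union>W\<in>\<W>. X closure_of W)"
    by (intro closure_of_locally_finite_Union locally_finite_in_subset[OF lf]) (auto simp: \<W>_def)
  have "X closure_of W \<inter> T = {}" if W: "W \<in> \<W>" for W
  proof -
    \<comment> \<open>A member meeting \<open>S\<close> is not contained in the complement of
      \<open>S\<close>, so it lies in some \<open>U s\<close>; the open set \<open>V s\<close> then
      misses its closure too.\<close>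
    obtain s where s: "s \<in> S" "W \<subseteq> U s"
      using W \<V>(3) by (fastforce simp: \<W>_def)
    have "V s \<inter> X closure_of W = {}"
      using UV[OF s(1)] s(2) openin_Int_closure_of_eq_empty[of X "V s" W] by (auto simp: disjnt_def)
    then show ?thesis
      using UV[OF s(1)] by blast
  qed
  then have "T \<subseteq> topspace X - X closure_of \<Union>\<W>"
    using cl \<open>T \<subseteq> topspace X\<close> by auto
  moreover have "S \<subseteq> \<Union>\<W>"
    using closedin_subset[OF S] unfolding \<W>_def \<V>(2)[symmetric] by blast
  moreover have "openin X (\<Union>\<W>)"
    using \<V>(1) by (auto simp: \<W>_def)
  moreover have "disjnt (\<Union>\<W>) (topspace X - X closure_of \<Union>\<W>)"
    using closure_of_subset[of "\<Union>\<W>" X] \<V>(1) openin_subset by (fastforce simp: disjnt_iff \<W>_def)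
  ultimately show ?thesis
    by (meson closedin_closure_of openin_diff openin_topspace)
qed

text \<open>The separation lemma is used twice: the Hausdorff property separates \<open>T\<close>
  from each point of \<open>S\<close>, and this in turn separates \<open>S\<close> from
  \<open>T\<close>.\<close>

lemma paracompact_Hausdorff_imp_normal_space:
  assumes X: "paracompact_space X" and H: "Hausdorff_space X"
  shows "normal_space X"
  unfolding normal_space_def
proof clarify
  fix S T
  assume S: "closedin X S" and T: "closedin X T" and "disjnt S T"
  have "\<exists>U V. openin X U \<and> openin X V \<and> T \<subseteq> U \<and> {s} \<subseteq> V \<and> disjnt U V" if "s \<in> S" for s
  proof (rule paracompact_space_separation[OF X T])
    show "{s} \<subseteq> topspace X"
      using that closedin_subset[OF S] by auto
    fix t assume "t \<in> T"
    then have "t \<noteq> s" "t \<in> topspace X" "s \<in> topspace X"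
      using that \<open>disjnt S T\<close> closedin_subset[OF S] closedin_subset[OF T] by (auto simp: disjnt_iff)
    then show "\<exists>U V. openin X U \<and> openin X V \<and> t \<in> U \<and> {s} \<subseteq> V \<and> disjnt U V"
      using H unfolding Hausdorff_space_def by auto
  qed
  then have "\<exists>U V. openin X U \<and> openin X V \<and> s \<in> U \<and> T \<subseteq> V \<and> disjnt U V" if "s \<in> S" for s
    using that by (metis disjnt_sym insert_subset)
  then show "\<exists>U V. openin X U \<and> openin X V \<and> S \<subseteq> U \<and> T \<subseteq> V \<and> disjnt U V"
    using paracompact_space_separation[OF X S closedin_subset[OF T]] by blast
qed

text \<open>Members of a locally finite refinement are merged according to a chosen index
  \<open>k V\<close>. Local finiteness by index survives because the indices active on
  \<open>N\<close> lie in the \<open>k\<close>-image of a finite set.\<close>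

lemma paracompact_space_indexed_refinement:
  assumes X: "paracompact_space X"
    and U: "\<forall>i\<in>I. openin X (U i)" and cover: "(\<Union>i\<in>I. U i) = topspace X"
  shows "\<exists>W. (\<forall>i\<in>I. openin X (W i) \<and> W i \<subseteq> U i) \<and> (\<Union>i\<in>I. W i) = topspace X \<and>
    (\<forall>x\<in>topspace X. \<exists>N. openin X N \<and> x \<in> N \<and> finite {i\<in>I. W i \<inter> N \<noteq> {}})"
proof -
  have "\<forall>V\<in>U ` I. openin X V" "\<Union>(U ` I) = topspace X"
    using U cover by auto
  then obtain \<V> where \<V>: "\<forall>V\<in>\<V>. openin X V" "\<Union>\<V> = topspace X" "\<forall>V\<in>\<V>. \<exists>V'\<in>U ` I. V \<subseteq> V'"
      and lf: "locally_finite_in X \<V>"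
    by (rule paracompact_space_refinement[OF X])
  then have "\<forall>V\<in>\<V>. \<exists>i\<in>I. V \<subseteq> U i"
    by blast
  then obtain k where k: "\<And>V. V \<in> \<V> \<Longrightarrow> k V \<in> I \<and> V \<subseteq> U (k V)"
    by metis
  define W where "W i = \<Union>{V\<in>\<V>. k V = i}" for i
  show ?thesis
  proof (intro exI[of _ W] conjI ballI)
    show "openin X (W i)" for i
      using \<V>(1) by (auto simp: W_def)
    show "W i \<subseteq> U i" for i
      using k by (auto simp: W_def)
    show "(\<Union>i\<in>I. W i) = topspace X"
      using k unfolding W_def \<V>(2)[symmetric] by blast
    fix x assume "x \<in> topspace X"
    then obtain N where N: "openin X N" "x \<in> N" "finite {V\<in>\<V>. V \<inter> N \<noteq> {}}"
      using lf unfolding locally_finite_in_def by blast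
    have "{i\<in>I. W i \<inter> N \<noteq> {}} \<subseteq> k ` {V\<in>\<V>. V \<inter> N \<noteq> {}}"
      by (auto simp: W_def)
    then show "\<exists>N. openin X N \<and> x \<in> N \<and> finite {i\<in>I. W i \<inter> N \<noteq> {}}"
      using N by (meson finite_imageI finite_subset)
  qed
qed

text \<open>Regularity lets the refinement consist of sets whose closures already fit into some
  \<open>U i\<close>. Since closure commutes with locally finite unions, merging them by index keeps
  the closure inside \<open>U i\<close>.\<close>

lemma paracompact_space_indexed_shrinking:
  assumes X: "paracompact_space X" and reg: "regular_space X"
    and U: "\<forall>i\<in>I. openin X (U i)" and cover: "(\<Union>i\<in>I. U i) = topspace X"
  shows "\<exists>C. (\<forall>i\<in>I. closedin X (C i) \<and> C i \<subseteq> U i) \<and> (\<Union>i\<in>I. C i) = topspace X"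
proof -
  let ?\<O> = "{G. openin X G \<and> (\<exists>i\<in>I. X closure_of G \<subseteq> U i)}"
  have "\<Union>?\<O> = topspace X"
  proof (intro equalityI subsetI)
    fix x assume x: "x \<in> topspace X"
    then obtain i where i: "i \<in> I" "x \<in> U i"
      using cover by auto
    then obtain G where "openin X G" "x \<in> G" "disjnt (topspace X - U i) (X closure_of G)"
      using reg U i x unfolding regular_space by (metis Diff_iff openin_closedin_eq)
    moreover from this(3) have "X closure_of G \<subseteq> U i"
      using closure_of_subset_topspace[of X G] by (auto simp: disjnt_iff)
    ultimately show "x \<in> \<Union>?\<O>"
      using i by blast
  qed (use openin_subset in blast)
  then obtain \<V> where \<V>: "\<forall>V\<in>\<V>. openin X V" "\<Union>\<V> = topspace X" "\<forall>V\<in>\<V>. \<exists>G\<in>?\<O>. V \<subseteq> G"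
      and lf: "locally_finite_in X \<V>"
    using paracompact_space_refinement[OF X, of ?\<O>] by force
  have "\<exists>i\<in>I. X closure_of V \<subseteq> U i" if V: "V \<in> \<V>" for V
  proof -
    obtain G i where "V \<subseteq> G" "i \<in> I" "X closure_of G \<subseteq> U i"
      using bspec[OF \<V>(3) V] by auto
    then show ?thesis
      using closure_of_mono[of V G X] by (meson order_trans)
  qed
  then obtain k where k: "\<And>V. V \<in> \<V> \<Longrightarrow> k V \<in> I \<and> X closure_of V \<subseteq> U (k V)"
    by metis
  define C where "C i = X closure_of \<Union>{V\<in>\<V>. k V = i}" for i
  have C: "C i = (\<Union>V\<in>{V\<in>\<V>. k V = i}. X closure_of V)" for i
    unfolding C_def by (intro closure_of_locally_finite_Union locally_finite_in_subset[OF lf]) auto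
  show ?thesis
  proof (intro exI[of _ C] conjI ballI)
    show "closedin X (C i)" for i
      by (simp add: C_def)
    show "C i \<subseteq> U i" for i
      using k by (auto simp: C)
    show "(\<Union>i\<in>I. C i) = topspace X"
    proof
      show "(\<Union>i\<in>I. C i) \<subseteq> topspace X"
        by (auto simp: C_def in_closure_of)
      show "topspace X \<subseteq> (\<Union>i\<in>I. C i)"
      proof
        fix x assume "x \<in> topspace X"
        then obtain V where V: "V \<in> \<V>" "x \<in> V"
          using \<V>(2) by blast
        then have "x \<in> X closure_of V"
          using closure_of_subset[OF openin_subset, of X V] \<V>(1) by blast
        then show "x \<in> (\<Union>i\<in>I. C i)"
          using V k[OF V(1)] unfolding C by blast
      qed
    qed
  qed
qed

lemma paracompact_Hausdorff_bump_functions: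
  fixes X :: "'a topology" and I :: "'i set"
  assumes X: "paracompact_space X" "Hausdorff_space X"
    and U: "\<forall>i\<in>I. openin X (U i)" and cover: "(\<Union>i\<in>I. U i) = topspace X"
  shows "\<exists>g :: 'i \<Rightarrow> 'a \<Rightarrow> real.
    (\<forall>i\<in>I. continuous_map X (top_of_set {0..1}) (g i) \<and> (\<forall>x\<in>topspace X. g i x \<noteq> 0 \<longrightarrow> x \<in> U i)) \<and>
    (\<forall>x\<in>topspace X. (\<exists>i\<in>I. g i x \<noteq> 0) \<and>
      (\<exists>N. openin X N \<and> x \<in> N \<and> finite {i\<in>I. \<exists>y\<in>N. g i y \<noteq> 0}))"
proof -
  have normal: "normal_space X"
    using X by (rule paracompact_Hausdorff_imp_normal_space)
  obtain W where W: "\<forall>i\<in>I. openin X (W i) \<and> W i \<subseteq> U i" and W_cover: "(\<Union>i\<in>I. W i) = topspace X"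
    and W_lf: "\<forall>x\<in>topspace X. \<exists>N. openin X N \<and> x \<in> N \<and> finite {i\<in>I. W i \<inter> N \<noteq> {}}"
    using paracompact_space_indexed_refinement[OF X(1) U cover] by blast
  have "regular_space X"
    using normal X(2) by (simp add: normal_t1_imp_regular_space Hausdorff_imp_t1_space)
  \<comment> \<open>The closed sets shrink \<open>W\<close> rather than \<open>U\<close>, so that
    Urysohn functions that are 1 on \<open>C i\<close> and 0 off \<open>W i\<close> inherit the
    local finiteness of \<open>W\<close>.\<close>
  then obtain C where C: "\<forall>i\<in>I. closedin X (C i) \<and> C i \<subseteq> W i" and C_cover: "(\<Union>i\<in>I. C i) = topspace X"
    using paracompact_space_indexed_shrinking[OF X(1) _ _ W_cover] W by blast
  have "\<exists>f::'a\<Rightarrow>real. continuous_map X (top_of_set {0..1}) f \<and> f ` (topspace X - W i) \<subseteq> {0} \<and> f ` C i \<subseteq> {1}"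
    if i: "i \<in> I" for i
  proof -
    have "closedin X (topspace X - W i)" "disjnt (topspace X - W i) (C i)"
      using W C i by (auto simp: disjnt_iff)
    then show ?thesis
      using Urysohn_lemma[OF normal, of "topspace X - W i" "C i" 0 1] C i zero_le_one by metis
  qed
  then obtain g :: "'i \<Rightarrow> 'a \<Rightarrow> real" where g: "\<And>i. i \<in> I \<Longrightarrow> continuous_map X (top_of_set {0..1}) (g i)
      \<and> g i ` (topspace X - W i) \<subseteq> {0} \<and> g i ` C i \<subseteq> {1}"
    by metis
  have gW: "x \<in> W i" if "i \<in> I" "x \<in> topspace X" "g i x \<noteq> 0" for i x
    using g that by blast
  show ?thesis
  proof (intro exI[of _ g] conjI ballI impI)
    show "continuous_map X (top_of_set {0..1}) (g i)" if "i \<in> I" for i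
      using g that by blast
    show "x \<in> U i" if "i \<in> I" "x \<in> topspace X" "g i x \<noteq> 0" for i x
      using gW[OF that] W that by blast
    fix x assume x: "x \<in> topspace X"
    then obtain i where "i \<in> I" "x \<in> C i"
      using C_cover by blast
    then show "\<exists>i\<in>I. g i x \<noteq> 0"
      using g[of i] by (intro bexI[of _ i]) auto
    obtain N where N: "openin X N" "x \<in> N" "finite {i\<in>I. W i \<inter> N \<noteq> {}}"
      using W_lf x by blast
    have "{i\<in>I. \<exists>y\<in>N. g i y \<noteq> 0} \<subseteq> {i\<in>I. W i \<inter> N \<noteq> {}}"
      using gW openin_subset[OF N(1)] by blast
    then show "\<exists>N. openin X N \<and> x \<in> N \<and> finite {i\<in>I. \<exists>y\<in>N. g i y \<noteq> 0}"
      using N finite_subset by blast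
  qed
qed

section \<open>Locally finite sums and countable intersections of zero sets\<close>

text \<open>The range of summation depends on \<open>x\<close>, but on a neighbourhood
  \<open>N\<close> the sum equals the one over the fixed finite set of indices active somewhere on
  \<open>N\<close>. These local descriptions are pasted together.\<close>

lemma continuous_map_locally_finite_sum:
  fixes g :: "'i \<Rightarrow> 'a \<Rightarrow> 'b::real_normed_vector"
  assumes cont: "\<And>i. i \<in> I \<Longrightarrow> continuous_map X euclidean (g i)"
    and lf: "\<And>x. x \<in> topspace X \<Longrightarrow> \<exists>N. openin X N \<and> x \<in> N \<and> finite {i\<in>I. \<exists>y\<in>N. g i y \<noteq> 0}"
  shows "continuous_map X euclidean (\<lambda>x. \<Sum>i | i \<in> I \<and> g i x \<noteq> 0. g i x)"
proof -
  have "\<forall>x\<in>topspace X. \<exists>N. openin X N \<and> x \<in> N \<and> finite {i\<in>I. \<exists>y\<in>N. g i y \<noteq> 0}"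
    using lf by simp
  from bchoice[OF this] obtain N
    where N: "\<forall>x\<in>topspace X. openin X (N x) \<and> x \<in> N x \<and> finite {i\<in>I. \<exists>y\<in>N x. g i y \<noteq> 0}" ..
  show ?thesis
  proof (rule pasting_lemma[where I = "topspace X" and T = N and f = "\<lambda>_ x. \<Sum>i | i \<in> I \<and> g i x \<noteq> 0. g i x"])
    fix x assume x: "x \<in> topspace X"
    show "openin X (N x)"
      using N x by blast
    show "continuous_map (subtopology X (N x)) euclidean (\<lambda>y. \<Sum>i | i \<in> I \<and> g i y \<noteq> 0. g i y)"
    proof (rule continuous_map_eq)
      show "continuous_map (subtopology X (N x)) euclidean (\<lambda>y. \<Sum>i\<in>{i\<in>I. \<exists>y\<in>N x. g i y \<noteq> 0}. g i y)"
        using bspec[OF N x] cont by (intro continuous_map_sum continuous_map_from_subtopology) auto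
      show "(\<Sum>i\<in>{i\<in>I. \<exists>y\<in>N x. g i y \<noteq> 0}. g i y) = (\<Sum>i | i \<in> I \<and> g i y \<noteq> 0. g i y)"
        if "y \<in> topspace (subtopology X (N x))" for y
        using bspec[OF N x] that by (intro sum.mono_neutral_right) auto
    qed
    show "\<exists>j. j \<in> topspace X \<and> x \<in> N j \<and> (\<Sum>i | i \<in> I \<and> g i x \<noteq> 0. g i x) = (\<Sum>i | i \<in> I \<and> g i x \<noteq> 0. g i x)"
      using N x by blast
  qed simp
qed

text \<open>A uniformly convergent series of nonnegative multiples of the \<open>c n\<close> is
  continuous and vanishes exactly where all terms do.\<close>

lemma countable_Int_zero_sets:
  fixes c :: "nat \<Rightarrow> 'a \<Rightarrow> real"
  assumes c: "\<And>n. continuous_map X (top_of_set {0..1}) (c n)"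
  obtains f where "continuous_map X (top_of_set {0..1::real}) f"
    "\<And>x. x \<in> topspace X \<Longrightarrow> f x = 0 \<longleftrightarrow> (\<forall>n. c n x = 0)"
proof -
  have range: "0 \<le> c n x" "c n x \<le> 1" if "x \<in> topspace X" for n x
    using c[of n] that by (auto simp: continuous_map_in_subtopology)
  \<comment> \<open>The weights start at 1/2 and add up to 1, which keeps the sum in [0,1].\<close>
  define s :: "nat \<Rightarrow> 'a \<Rightarrow> real" where "s n x = (1/2) ^ Suc n * c n x" for n x
  have s: "0 \<le> s n x" "s n x \<le> (1/2) ^ Suc n" if "x \<in> topspace X" for n x
    using range[OF that, of n] by (auto simp: s_def field_simps)
  have summable: "summable (\<lambda>n. s n x)" if "x \<in> topspace X" for x
    by (rule summable_comparison_test'[OF sums_summable[OF power_half_series], where N = 0])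
       (use s[OF that] in auto)
  have lim: "uniform_limit (topspace X) (\<lambda>n x. \<Sum>i<n. s i x) (\<lambda>x. \<Sum>i. s i x) sequentially"
    by (rule Weierstrass_m_test[OF _ sums_summable[OF power_half_series]]) (use s in auto)
  have "continuous_map X Met_TC.mtopology (\<lambda>x. \<Sum>i. s i x)"
  proof (rule Met_TC.continuous_map_uniform_limit)
    show "\<forall>\<^sub>F n in sequentially. continuous_map X Met_TC.mtopology (\<lambda>x. \<Sum>i<n. s i x)"
    proof (intro always_eventually allI)
      fix n
      have "continuous_map X euclideanreal (c i)" for i
        using c[of i] by (simp add: continuous_map_in_subtopology)
      then show "continuous_map X Met_TC.mtopology (\<lambda>x. \<Sum>i<n. s i x)"
        unfolding s_def mtopology_is_euclidean
        by (intro continuous_map_sum continuous_map_real_mult continuous_map_const[THEN iffD2]) auto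
    qed
    show "\<forall>\<^sub>F n in sequentially. \<forall>x\<in>topspace X. (\<Sum>i. s i x) \<in> UNIV \<and> dist (\<Sum>i<n. s i x) (\<Sum>i. s i x) < \<epsilon>"
      if "\<epsilon> > 0" for \<epsilon>
      using lim that unfolding uniform_limit_iff by simp
  qed simp
  moreover have "0 \<le> (\<Sum>i. s i x)" if "x \<in> topspace X" for x
    using summable[OF that] s[OF that] by (intro suminf_nonneg) auto
  moreover have "(\<Sum>i. s i x) \<le> 1" if "x \<in> topspace X" for x
    by (rule sums_le[OF _ summable_sums[OF summable[OF that]] power_half_series]) (rule s(2)[OF that])
  ultimately have "continuous_map X (top_of_set {0..1}) (\<lambda>x. \<Sum>i. s i x)"
    by (simp add: continuous_map_in_subtopology mtopology_is_euclidean Pi_iff image_subset_iff)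
  moreover have "(\<Sum>i. s i x) = 0 \<longleftrightarrow> (\<forall>n. c n x = 0)" if "x \<in> topspace X" for x
    using suminf_eq_zero_iff[OF summable[OF that]] s[OF that] by (simp add: s_def)
  ultimately show thesis
    using that by blast
qed

section \<open>Realcompactness\<close>

text \<open>
  Suppose the conclusion, which says that \<open>X\<close> is realcompact, fails at \<open>q\<close>. Then every continuous
  \<open>f : B \<rightarrow> [0,1]\<close> vanishing at \<open>q\<close> vanishes somewhere on \<open>X\<close>, so countably many values at \<open>q\<close> are attained
  simultaneously at a point of \<open>X\<close>. Apply this to the sums, over sets \<open>J\<close> of indices, of locally
  finite bump functions whose extensions vanish at \<open>q\<close>: the sets \<open>J\<close> for which the extended sum
  does not vanish at \<open>q\<close> yield a two-valued measure.
\<close>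

lemma paracompact_Hausdorff_nonmeasurable_imp_realcompact:
  fixes X :: "'a topology" and B :: "'b topology"
  assumes X: "paracompact_space X" "Hausdorff_space X"
    and nonmeasurable: "\<not> measurable_cardinal (card_of (topspace X))"
    and SC: "stone_cech_compactification X B e"
    and q: "q \<in> topspace B" "q \<notin> e ` topspace X"
  shows "\<exists>f. continuous_map B (top_of_set {0..1::real}) f \<and> f q = 0 \<and> (\<forall>x\<in>topspace X. f (e x) \<noteq> 0)"
proof (rule ccontr)
  assume "\<not> ?thesis"
  then have zero: "\<exists>x\<in>topspace X. f (e x) = 0"
    if "continuous_map B (top_of_set {0..1::real}) f" "f q = 0" for f
    using that by blast
  have HB: "Hausdorff_space B" and dense: "B closure_of (e ` topspace X) = topspace B"
    and ext: "\<And>f. continuous_map X (top_of_set {0..1::real}) f \<Longrightarrow>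
        \<exists>g. continuous_map B (top_of_set {0..1::real}) g \<and> (\<forall>x\<in>topspace X. g (e x) = f x)"
    and e: "continuous_map X B e"
    using SC by (auto simp: stone_cech_compactification_def embedding_map_def
        homeomorphic_eq_everything_map continuous_map_in_subtopology)
  have eX: "e x \<in> topspace B" if "x \<in> topspace X" for x
    using e that by (auto simp: continuous_map_def)
  have "\<exists>G N. openin B G \<and> openin B N \<and> e x \<in> G \<and> q \<in> N \<and> disjnt G N" if "x \<in> topspace X" for x
    using HB eX[OF that] q that unfolding Hausdorff_space_def by (metis imageI)
  then obtain G N where ON: "\<And>x. x \<in> topspace X \<Longrightarrow>
      openin B (G x) \<and> openin B (N x) \<and> e x \<in> G x \<and> q \<in> N x \<and> disjnt (G x) (N x)"
    by metis
  \<comment> \<open>Since \<open>G x\<close> misses the neighbourhood \<open>N x\<close> of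
    \<open>q\<close>, a function on \<open>X\<close> vanishing off \<open>U x\<close> will have an
    extension that vanishes at \<open>q\<close>.\<close>
  define U where "U x = {y \<in> topspace X. e y \<in> G x}" for x
  have U: "\<forall>x\<in>topspace X. openin X (U x)"
    unfolding U_def using e ON by (auto intro: openin_continuous_map_preimage)
  have "(\<Union>x\<in>topspace X. U x) = topspace X"
    using ON by (auto simp: U_def)
  \<comment> \<open>The bump functions are indexed by the points of \<open>X\<close>, so the measure
    to be built lives on \<open>topspace X\<close> itself.\<close>
  from paracompact_Hausdorff_bump_functions[OF X U this] obtain g :: "'a \<Rightarrow> 'a \<Rightarrow> real" where
    gX: "\<forall>i\<in>topspace X. continuous_map X (top_of_set {0..1}) (g i) \<and>
        (\<forall>x\<in>topspace X. g i x \<noteq> 0 \<longrightarrow> x \<in> U i)"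
    and lf: "\<forall>x\<in>topspace X. (\<exists>i\<in>topspace X. g i x \<noteq> 0) \<and>
        (\<exists>N. openin X N \<and> x \<in> N \<and> finite {i\<in>topspace X. \<exists>y\<in>N. g i y \<noteq> 0})"
    by (elim exE conjE)
  have g: "continuous_map X (top_of_set {0..1}) (g i)" if "i \<in> topspace X" for i
    using gX that by blast
  have gU: "x \<in> U i" if "i \<in> topspace X" "x \<in> topspace X" "g i x \<noteq> 0" for i x
    using gX that by blast
  have g0: "0 \<le> g i x" if "i \<in> topspace X" "x \<in> topspace X" for i x
    using g that by (force simp: continuous_map_in_subtopology)
  define F where "F x = {i \<in> topspace X. g i x \<noteq> 0}" for x
  have finF: "finite (F x)" if x: "x \<in> topspace X" for x
  proof -
    obtain M where "x \<in> M" "finite {i\<in>topspace X. \<exists>y\<in>M. g i y \<noteq> 0}"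
      using bspec[OF lf x] by (elim exE conjE)
    then show ?thesis
      unfolding F_def by (elim rev_finite_subset) auto
  qed
  \<comment> \<open>Truncation at 1 makes the extension property applicable and does not change the
    zeros of the nonnegative sum.\<close>
  define \<psi> where "\<psi> J x = min 1 (\<Sum>i\<in>J \<inter> F x. g i x)" for J x
  have \<psi>: "continuous_map X (top_of_set {0..1}) (\<psi> J)" for J
  proof -
    have "continuous_map X euclideanreal (\<lambda>x. \<Sum>i | i \<in> J \<inter> topspace X \<and> g i x \<noteq> 0. g i x)"
    proof (rule continuous_map_locally_finite_sum)
      show "continuous_map X euclideanreal (g i)" if "i \<in> J \<inter> topspace X" for i
        using g that by (auto simp: continuous_map_in_subtopology)
      show "\<exists>N. openin X N \<and> x \<in> N \<and> finite {i \<in> J \<inter> topspace X. \<exists>y\<in>N. g i y \<noteq> 0}"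
        if x: "x \<in> topspace X" for x
      proof -
        obtain M where M: "openin X M" "x \<in> M" "finite {i\<in>topspace X. \<exists>y\<in>M. g i y \<noteq> 0}"
          using bspec[OF lf x] by (elim exE conjE)
        moreover have "finite {i \<in> J \<inter> topspace X. \<exists>y\<in>M. g i y \<noteq> 0}"
          by (rule finite_subset[OF _ M(3)]) auto
        ultimately show ?thesis
          by blast
      qed
    qed
    moreover have "{i. i \<in> J \<inter> topspace X \<and> g i x \<noteq> 0} = J \<inter> F x" for x
      by (auto simp: F_def)
    ultimately have "continuous_map X euclideanreal (\<psi> J)"
      unfolding \<psi>_def by (simp add: continuous_map_real_min)
    moreover have "0 \<le> \<psi> J x" "\<psi> J x \<le> 1" if "x \<in> topspace X" for x
      using g0 that by (auto simp: \<psi>_def F_def intro!: sum_nonneg)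
    ultimately show ?thesis
      by (auto simp: continuous_map_in_subtopology)
  qed
  have \<psi>_zero_iff: "\<psi> J x = 0 \<longleftrightarrow> J \<inter> F x = {}" if x: "x \<in> topspace X" for J x
  proof -
    have "(\<Sum>i\<in>J \<inter> F x. g i x) = 0 \<longleftrightarrow> (\<forall>i\<in>J \<inter> F x. g i x = 0)"
      using finF[OF x] g0[OF _ x] by (intro sum_nonneg_eq_0_iff) (auto simp: F_def)
    then show ?thesis
      by (auto simp: \<psi>_def F_def min_def)
  qed
  obtain h where h: "\<And>J. continuous_map B (top_of_set {0..1}) (h J)"
      and h\<psi>: "\<And>J x. x \<in> topspace X \<Longrightarrow> h J (e x) = \<psi> J x"
    using ext[OF \<psi>] by metis
  have "\<exists>\<mu>. nontrivial_two_valued_measure (topspace X) \<mu>"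
  proof (rule two_valued_measure_of_finite_traces[where X = "topspace X" and F = F and P = "\<lambda>J. h J q \<noteq> 0"])
    fix J :: "nat \<Rightarrow> 'a set"
    have hr: "h A b \<in> {0..1}" if "b \<in> topspace B" for A b
      using h[of A] that by (auto simp: continuous_map_in_subtopology)
    \<comment> \<open>The countably many conditions \<open>h (J n) b = h (J n) q\<close> become one
      zero set containing \<open>q\<close>. By \<open>zero\<close> it contains some
      \<open>e x\<close>, and this \<open>x\<close> realises all the values at
      \<open>q\<close>.\<close>
    have "continuous_map B (top_of_set {0..1}) (\<lambda>b. \<bar>h (J n) b - h (J n) q\<bar>)" for n
    proof -
      have "continuous_map B euclideanreal (h (J n))"
        using h[of "J n"] by (simp add: continuous_map_in_subtopology)
      then have "continuous_map B euclideanreal (\<lambda>b. \<bar>h (J n) b - h (J n) q\<bar>)"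
        by (intro continuous_map_real_abs continuous_map_diff) auto
      moreover have "\<bar>h (J n) b - h (J n) q\<bar> \<le> 1" if "b \<in> topspace B" for b
        using hr[OF that, of "J n"] hr[OF q(1), of "J n"] by (auto simp: abs_le_iff)
      ultimately show ?thesis
        by (auto simp: continuous_map_in_subtopology)
    qed
    then obtain f where f: "continuous_map B (top_of_set {0..1::real}) f"
      "\<And>b. b \<in> topspace B \<Longrightarrow> f b = 0 \<longleftrightarrow> (\<forall>n. \<bar>h (J n) b - h (J n) q\<bar> = 0)"
      using countable_Int_zero_sets[of B "\<lambda>n b. \<bar>h (J n) b - h (J n) q\<bar>"] by metis
    then obtain x where x: "x \<in> topspace X" "f (e x) = 0"
      using zero q(1) by fastforce
    then have "h (J n) q = \<psi> (J n) x" for n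
      using f(2)[OF eX] h\<psi> by simp
    then show "\<exists>x\<in>topspace X. \<forall>n. h (J n) q \<noteq> 0 \<longleftrightarrow> J n \<inter> F x \<noteq> {}"
      using x(1) \<psi>_zero_iff by auto
  next
    fix i assume i: "i \<in> topspace X"
    show "\<not> h {i} q \<noteq> 0"
    proof
      assume ne: "h {i} q \<noteq> 0"
      \<comment> \<open>By density the neighbourhood \<open>M\<close> of \<open>q\<close> contains
        some \<open>e x\<close>. There \<open>h {i}\<close> is nonzero, which puts
        \<open>e x\<close> into \<open>G i\<close>, although \<open>N i\<close> is disjoint from
        \<open>G i\<close>.\<close>
      define M where "M = N i \<inter> {b \<in> topspace B. h {i} b \<in> - {0}}"
      have "openin B {b \<in> topspace B. h {i} b \<in> - {0}}"
        using h[of "{i}"] by (intro openin_continuous_map_preimage[where Y = euclideanreal])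
          (auto simp: continuous_map_in_subtopology)
      then have "openin B M"
        using ON[OF i] unfolding M_def by blast
      moreover have "q \<in> M"
        using ON[OF i] q(1) ne by (simp add: M_def)
      moreover have "q \<in> B closure_of (e ` topspace X)"
        using q(1) dense by simp
      ultimately obtain x where x: "x \<in> topspace X" "e x \<in> M"
        by (auto simp: in_closure_of)
      then have x': "e x \<in> N i" "h {i} (e x) \<noteq> 0"
        by (auto simp: M_def)
      then have "i \<in> F x"
        using h\<psi>[OF x(1)] \<psi>_zero_iff[OF x(1)] by auto
      then have "x \<in> U i"
        using gU[OF i x(1)] by (simp add: F_def)
      then show False
        using ON[OF i] x'(1) by (auto simp: U_def disjnt_iff)
    qed
  next
    fix x assume x: "x \<in> topspace X"
    show "finite (F x)" "F x \<noteq> {}" "F x \<subseteq> topspace X"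
      using finF[OF x] bspec[OF lf x] by (auto simp: F_def)
  qed
  then show False
    using nonmeasurable by (simp add: measurable_cardinal_card_of_iff)
qed

section \<open>Oscillation at the first zero\<close>

text \<open>Left of its first zero \<open>T\<close>, \<open>u\<close> takes all sufficiently small
  positive values arbitrarily close to \<open>T\<close>, by the intermediate value theorem. So
  \<open>v\<close> takes both values 1 and -1 there and cannot be continuous at
  \<open>T\<close>.\<close>

lemma no_oscillating_limit:
  fixes u v :: "real \<Rightarrow> real"
  assumes u: "continuous_on {0..1} u" and v: "continuous_on {0..1} v"
    and pos: "\<And>t. t \<in> {0..1} \<Longrightarrow> 0 \<le> u t" and u0: "u 0 \<noteq> 0" and u1: "u 1 = 0"
    and osc: "\<And>t. t \<in> {0..1} \<Longrightarrow> u t \<noteq> 0 \<Longrightarrow> v t = sin (1 / u t)"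
  shows False
proof -
  define Z where "Z = {t\<in>{0..1}. u t = 0}"
  have "closed Z"
    unfolding Z_def using continuous_closed_preimage_constant[OF u closed_atLeastAtMost] by simp
  moreover have "1 \<in> Z" "bdd_below Z"
    using u1 by (auto simp: Z_def intro: bdd_belowI[of _ 0])
  ultimately have T: "Inf Z \<in> Z" and least: "\<And>t. t \<in> Z \<Longrightarrow> Inf Z \<le> t"
    using closed_contains_Inf[of Z] cInf_lower by blast+
  define T where "T = Inf Z"
  have T01: "0 < T" "T \<le> 1" and uT: "u T = 0"
    using T u0 unfolding T_def[symmetric] by (auto simp: Z_def less_le)
  have ne: "u t \<noteq> 0" if "0 \<le> t" "t < T" for t
  proof
    assume "u t = 0"
    then have "t \<in> Z"
      using that T01 by (simp add: Z_def)
    then show False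
      using least[of t] that by (simp add: T_def)
  qed
  have "T \<in> {0..1}"
    using T01 by simp
  then obtain d where d: "d > 0" "\<And>t. t \<in> {0..1} \<Longrightarrow> \<bar>t - T\<bar> < d \<Longrightarrow> \<bar>v t - v T\<bar> < 1"
    using v[unfolded continuous_on_iff, rule_format, of T 1] by (auto simp: dist_real_def)
  define a where "a = max 0 (T - d/2)"
  have a: "0 \<le> a" "a < T" "T - d < a"
    using d(1) T01 by (auto simp: a_def)
  then have "0 < u a"
    using ne[of a] pos[of a] T01 by force
  \<comment> \<open>With this \<open>n\<close>, every \<open>r\<close> from \<open>n\<close> on
    satisfies \<open>1 / r \<le> u a\<close>, so \<open>1 / r\<close> is a value of \<open>u\<close>
    between \<open>a\<close> and \<open>T\<close>.\<close>
  obtain n :: nat where n: "1 / u a < real n"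
    using reals_Archimedean2 by blast
  have attained: "\<exists>t. t \<in> {0..1} \<and> \<bar>t - T\<bar> < d \<and> v t = sin r" if r: "real n \<le> r" for r
  proof -
    have "0 < r"
      using n r \<open>0 < u a\<close> by (smt (verit) divide_pos_pos)
    then have "u T \<le> 1 / r"
      using uT by simp
    moreover have "1 / r \<le> u a"
      using less_le_trans[OF n r] \<open>0 < u a\<close> \<open>0 < r\<close> by (simp add: field_simps)
    moreover have "continuous_on {a..T} u"
      using u by (rule continuous_on_subset) (use a T01 in auto)
    ultimately obtain t where t: "a \<le> t" "t \<le> T" "u t = 1 / r"
      using IVT2'[of u T "1/r" a] a by auto
    then show ?thesis
      using osc[of t] a T01 \<open>0 < r\<close> by (intro exI[of _ t]) auto
  qed
  have big: "real n \<le> 2 * pi * real n"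
    using pi_ge_two by (simp add: mult_le_cancel_right1)
  have sin1: "sin (2 * pi * real n + pi/2) = 1"
    by (simp add: sin_add sin_integer_2pi cos_integer_2pi)
  have sin2: "sin (2 * pi * real n + 3/2*pi) = -1"
    unfolding sin_add sin_3over2_pi by (simp add: sin_integer_2pi cos_integer_2pi)
  obtain s where "s \<in> {0..1}" "\<bar>s - T\<bar> < d" "v s = 1"
    using attained[of "2 * pi * real n + pi/2"] big sin1 pi_gt_zero by auto
  moreover obtain t where "t \<in> {0..1}" "\<bar>t - T\<bar> < d" "v t = -1"
    using attained[of "2 * pi * real n + 3/2*pi"] big sin2 pi_gt_zero by auto
  \<comment> \<open>\<open>v T\<close> would be at distance less than 1 from both 1 and -1.\<close>
  ultimately show False
    using d(2)[of s] d(2)[of t] by (auto simp: abs_if split: if_splits)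
qed

section \<open>No path leaves the image of \<open>X\<close>\<close>

theorem theorem3:
  fixes X :: "'a topology" and B :: "'b topology" and e :: "'a \<Rightarrow> 'b"
  assumes "topspace X \<noteq> {}" and "path_connected_space X"
    and "paracompact_space X" and "Hausdorff_space X"
    and "\<not> measurable_cardinal (card_of (topspace X))"
    and "stone_cech_compactification X B e"
  shows "e ` topspace X \<in> path_components_of B"
proof -
  have HB: "Hausdorff_space B" and dense: "B closure_of (e ` topspace X) = topspace B"
    and ext: "\<And>f. continuous_map X (top_of_set {0..1::real}) f \<Longrightarrow>
        \<exists>g. continuous_map B (top_of_set {0..1::real}) g \<and> (\<forall>x\<in>topspace X. g (e x) = f x)"
    and e: "continuous_map X B e"
    using assms(6) by (auto simp: stone_cech_compactification_def embedding_map_def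
        homeomorphic_eq_everything_map continuous_map_in_subtopology)
  have eX: "e ` topspace X \<subseteq> topspace B"
    using e by (auto simp: continuous_map_def)
  obtain x0 where x0: "x0 \<in> topspace X"
    using assms(1) by blast
  have "path_connectedin B (e ` topspace X)"
    using path_connectedin_continuous_map_image[OF e] assms(2) path_connectedin_topspace by blast
  then have "e ` topspace X \<subseteq> path_component_of_set B (e x0)"
    using x0 by (intro path_component_of_maximal) auto
  moreover have "q \<in> e ` topspace X" if x0q: "path_component_of B (e x0) q" for q
  proof (rule ccontr)
    assume q: "q \<notin> e ` topspace X"
    obtain p :: "real \<Rightarrow> 'b"
      where p: "continuous_map (top_of_set {0..1}) B p" "p 0 = e x0" "p 1 = q"
      using x0q unfolding path_component_of_def pathin_def by blast
    have pB: "p t \<in> topspace B" if "t \<in> {0..1}" for t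
      using p(1) that by (auto simp: continuous_map_def)
    have "q \<in> topspace B"
      using pB[of 1] p(3) by simp
    then obtain f where f: "continuous_map B (top_of_set {0..1::real}) f" "f q = 0"
        and fX: "\<And>x. x \<in> topspace X \<Longrightarrow> f (e x) \<noteq> 0"
      using paracompact_Hausdorff_nonmeasurable_imp_realcompact[OF assms(3-6) _ q] by blast
    have fB: "continuous_map B euclideanreal f"
      using f(1) by (simp add: continuous_map_in_subtopology)
    \<comment> \<open>\<open>Y\<close> is the open set where \<open>f\<close> does not vanish: it
      contains the image of \<open>X\<close>, and \<open>sin (1 / f)\<close> is continuous on
      it.\<close>
    define Y where "Y = subtopology B {b \<in> topspace B. f b \<in> - {0}}"
    have opY: "openin B {b \<in> topspace B. f b \<in> - {0}}"
      using fB by (rule openin_continuous_map_preimage) auto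
    have eXY: "e ` topspace X \<subseteq> topspace Y"
      using eX fX by (auto simp: Y_def)
    have "continuous_map Y (top_of_set (- {0})) f"
      using fB unfolding Y_def by (auto simp: continuous_map_in_subtopology continuous_map_from_subtopology)
    moreover have "continuous_map (top_of_set (- {0})) euclideanreal (\<lambda>s. sin (1 / s))"
      by (auto intro!: continuous_intros)
    ultimately have sinY: "continuous_map Y euclideanreal (\<lambda>b. sin (1 / f b))"
      using continuous_map_compose[of Y _ f euclideanreal "\<lambda>s. sin (1 / s)"] by (simp add: o_def)
    have "continuous_map X Y e"
      using e eXY by (auto simp: Y_def continuous_map_in_subtopology)
    then have "continuous_map X euclideanreal (\<lambda>x. sin (1 / f (e x)))"
      using continuous_map_compose[OF _ sinY, of X e] by (simp add: o_def)
    \<comment> \<open>The extension property concerns [0,1]-valued functions, so the sine is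
      rescaled affinely; \<open>w\<close> below undoes the rescaling.\<close>
    then have "continuous_map X euclideanreal (\<lambda>x. (1 + sin (1 / f (e x))) / 2)"
      by (intro continuous_intros) auto
    moreover have "(1 + sin r) / 2 \<in> {0..1}" for r :: real
      using sin_ge_minus_one[of r] sin_le_one[of r] by (simp del: sin_ge_minus_one sin_le_one)
    ultimately have "continuous_map X (top_of_set {0..1}) (\<lambda>x. (1 + sin (1 / f (e x))) / 2)"
      by (auto simp: continuous_map_in_subtopology simp del: atLeastAtMost_iff)
    then obtain k where k: "continuous_map B (top_of_set {0..1::real}) k"
        and kX: "\<And>x. x \<in> topspace X \<Longrightarrow> k (e x) = (1 + sin (1 / f (e x))) / 2"
      using ext by blast
    define w where "w b = 2 * k b - 1" for b
    have kB: "continuous_map B euclideanreal k"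
      using k by (simp add: continuous_map_in_subtopology)
    have wB: "continuous_map B euclideanreal w"
      unfolding w_def using kB by (intro continuous_intros) auto
    \<comment> \<open>Both sides are continuous on \<open>Y\<close> and agree on the image of
      \<open>X\<close>, which is dense in \<open>Y\<close> because it is dense in \<open>B\<close>
      and \<open>Y\<close> is open.\<close>
    have w: "w b = sin (1 / f b)" if b: "b \<in> topspace Y" for b
    proof (rule forall_in_closure_of_eq[of b Y "e ` topspace X" euclideanreal w "\<lambda>b. sin (1 / f b)"])
      have "Y closure_of (e ` topspace X) = {b \<in> topspace B. f b \<in> - {0}} \<inter> topspace B"
        unfolding Y_def closure_of_subtopology_open[OF disjI1[OF opY]] dense ..
      also have "\<dots> = topspace Y"
        by (auto simp: Y_def)
      finally have "Y closure_of (e ` topspace X) = topspace Y" .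
      then show "b \<in> Y closure_of (e ` topspace X)"
        using b by simp
      show "continuous_map Y euclideanreal w"
        using wB by (simp add: Y_def continuous_map_from_subtopology)
      show "w y = sin (1 / f y)" if "y \<in> e ` topspace X" for y
        using that kX by (auto simp: w_def field_simps)
    qed (use sinY in auto)
    have "continuous_on {0..1} (f \<circ> p)" "continuous_on {0..1} (w \<circ> p)"
      using continuous_map_compose[OF p(1) fB] continuous_map_compose[OF p(1) wB]
      by (simp_all only: continuous_map_iff_continuous)
    moreover have "0 \<le> f (p t)" if "t \<in> {0..1}" for t
      using f(1) pB[OF that] by (auto simp: continuous_map_in_subtopology)
    moreover have "(w \<circ> p) t = sin (1 / (f \<circ> p) t)" if "t \<in> {0..1}" "(f \<circ> p) t \<noteq> 0" for t
      using w[of "p t"] pB[OF that(1)] that(2) by (simp add: Y_def)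
    ultimately show False
      using no_oscillating_limit[of "f \<circ> p" "w \<circ> p"] p f(2) fX[OF x0] by simp
  qed
  ultimately have "e ` topspace X = path_component_of_set B (e x0)"
    by blast
  then show ?thesis
    using x0 eX by (auto simp: path_components_of_def)
qed

end
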